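(* Let $p$ be a prime with $p \equiv 3 \pmod 4$ and let $d \in \mathbb{F}_p$ with $d \neq 0, 1$. Suppose that $$\sum_{j=0}^{\frac{p-1}{2}} \left(C_{\frac{p-1}{2}}^{j}\right)^{2} d^{j} \equiv 0 \pmod p.$$ Then the orders of the curves $x^2+y^2=1+dx^2y^2$ and $x^2+y^2=1+d^{-1}x^2y^2$ over $\mathbb{F}_p$ are both equal to $p+1$ when $\left(\frac{d}{p}\right)=-1$, and both equal to $p-3$ when $\left(\frac{d}{p}\right)=1$.
   Context: For $d\in\mathbb{F}_p^*$, $d\neq 1$, the Edwards curve $E_d$ is $x^2+y^2=1+dx^2y^2$. The order of the curve $E_d$ over $\mathbb{F}_p$, denoted $N_{d[p]}$, is the number of affine solutions $(x,y)\in\mathbb{F}_p^2$ of this equation. $C_n^j$ denotes the binomial coefficient $\binom{n}{j}$ and $\left(\frac{d}{p}\right)$ the Legendre symbol. *)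

theory Defs
  imports "HOL-Number_Theory.Number_Theory"
begin

text \<open>
  Elements of the prime field with \<open>p\<close> elements are given by integers modulo \<open>p\<close>. A coefficient
  \<open>d\<close> may be any representative of its class; points of a curve are counted through the canonical
  representatives, so that each point is counted exactly once.
\<close>

definition edwards_points :: "nat \<Rightarrow> int \<Rightarrow> (int \<times> int) set" where
  "edwards_points p d =
     {(x, y). x \<in> {0..<int p} \<and> y \<in> {0..<int p} \<and>
              [x\<^sup>2 + y\<^sup>2 = 1 + d * x\<^sup>2 * y\<^sup>2] (mod int p)}"

definition edwards_order :: "nat \<Rightarrow> int \<Rightarrow> nat" where
  "edwards_order p d = card (edwards_points p d)"

end

theory Submission
  imports Defs
begin

text \<open>
  Write \<open>p = 2 m + 1\<close> and let \<open>N\<close> be the order of the curve. Solved for \<open>x\<close>, the equation reads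
  \<open>(1 - d y\<^sup>2) x\<^sup>2 = 1 - y\<^sup>2\<close>, which has \<open>1 + L((1 - d y\<^sup>2) (1 - y\<^sup>2))\<close> solutions, \<open>L\<close> being the
  Legendre symbol, except that it has none if \<open>d y\<^sup>2 = 1\<close>. Replacing \<open>L\<close> by the \<open>m\<close>-th power (Euler)
  and summing over \<open>y\<close>, only the coefficients of \<open>y\<^sup>p\<^sup>-\<^sup>1\<close> and \<open>y\<^sup>2\<^sup>p\<^sup>-\<^sup>2\<close> survive modulo \<open>p\<close>. They are
  \<open>\<plusminus>\<close> the binomial sum of the hypothesis and \<open>d\<^sup>m \<equiv> L(d)\<close>, so that \<open>N \<equiv> -1 - 2 L(d)\<close>. No Hasse bound is
  needed to pin down \<open>N\<close>: the fibres over \<open>y = 1\<close> and \<open>y = -1\<close> are single points and those over the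
  roots of \<open>d y\<^sup>2 = 1\<close> are empty, whence \<open>2 \<le> N \<le> 2 p - 2 (1 + L(d)) - 2\<close>. The hypothesis passes to
  \<open>d\<^sup>-\<^sup>1\<close> because the sequence of squared binomial coefficients is palindromic.
\<close>

section \<open>Quadratic equations modulo \<open>p\<close>\<close>

text \<open>Multiplied by the unit \<open>u\<close>, the equation becomes
  \<open>(u * x)^2 = u * v\<close>, so it is solvable iff \<open>u * v\<close> is a square. A
  nonzero solution comes together with its negative, which is distinct because \<open>p\<close> is
  odd.\<close>

lemma card_quadratic_solutions:
  fixes p :: nat and u v :: int
  assumes "prime p" "2 < p" "\<not> [u = 0] (mod int p)"
  shows "int (card {x \<in> {0..<int p}. [u * x\<^sup>2 = v] (mod int p)}) = 1 + Legendre (u * v) (int p)"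
proof -
  let ?S = "{x \<in> {0..<int p}. [u * x\<^sup>2 = v] (mod int p)}"
  have prime_p: "prime (int p)"
    using assms(1) by simp
  have ndvd_u: "\<not> int p dvd u"
    using assms(3) by (simp add: cong_0_iff)
  have square_eq: "int p dvd x - y \<or> int p dvd x + y"
    if "[u * x\<^sup>2 = u * y\<^sup>2] (mod int p)" for x y
  proof -
    have "int p dvd u * ((x - y) * (x + y))"
      using that by (simp add: cong_iff_dvd_diff algebra_simps power2_eq_square)
    then show ?thesis
      using prime_p ndvd_u by (simp add: prime_dvd_mult_iff)
  qed
  show ?thesis
  proof (cases "[v = 0] (mod int p)")
    case True
    have "x = 0" if "x \<in> ?S" for x
    proof -
      have "[u * x\<^sup>2 = u * 0\<^sup>2] (mod int p)"
        using that True by (auto intro: cong_trans)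
      from square_eq[OF this] have "int p dvd x" by auto
      then show ?thesis
        using that by (auto dest: zdvd_imp_le)
    qed
    moreover have "0 \<in> ?S"
      using True assms(2) by (auto simp: cong_sym_eq)
    ultimately have "?S = {0}" by blast
    moreover have "[u * v = 0] (mod int p)"
      using True by (simp add: cong_0_iff)
    ultimately show ?thesis
      by (simp add: Legendre_def)
  next
    case False
    then have nz: "\<not> [u * v = 0] (mod int p)"
      using ndvd_u prime_p by (simp add: cong_0_iff prime_dvd_mult_iff)
    show ?thesis
    proof (cases "?S = {}")
      case True
      have "\<not> QuadRes (int p) (u * v)"
      proof
        assume "QuadRes (int p) (u * v)"
        then obtain y where y: "[y\<^sup>2 = u * v] (mod int p)"
          unfolding QuadRes_def by blast
        obtain w where w: "[u * w = 1] (mod int p)"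
          using prime_p ndvd_u by (metis cong_solve_coprime_int coprime_commute prime_imp_coprime)
        \<comment> \<open>From \<open>(u * x)^2 = u * v = y^2\<close> the candidate is
          \<open>y / u\<close>, with \<open>w\<close> as the inverse of \<open>u\<close>; the
          reduction puts it among the canonical representatives.\<close>
        define x where "x = y * w mod int p"
        have "[x = y * w] (mod int p)"
          by (simp add: x_def)
        then have "[u * x\<^sup>2 = u * (y * w)\<^sup>2] (mod int p)"
          by (intro cong_mult cong_pow cong_refl)
        also have "u * (y * w)\<^sup>2 = y\<^sup>2 * (u * w * w)"
          by (simp add: power2_eq_square algebra_simps)
        also have "[y\<^sup>2 * (u * w * w) = u * v * (u * w * w)] (mod int p)"
          by (intro cong_mult y cong_refl)
        also have "u * v * (u * w * w) = v * ((u * w) * (u * w))"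
          by (simp add: algebra_simps)
        also have "[v * ((u * w) * (u * w)) = v * (1 * 1)] (mod int p)"
          by (intro cong_mult w cong_refl)
        finally have "[u * x\<^sup>2 = v] (mod int p)" by simp
        then have "x \<in> ?S"
          using assms(2) by (simp add: x_def)
        with True show False by blast
      qed
      with nz show ?thesis
        unfolding True by (simp add: Legendre_def)
    next
      case nonempty: False
      then obtain a where a: "0 \<le> a" "a < int p" "[u * a\<^sup>2 = v] (mod int p)"
        by auto
      have "a \<noteq> 0"
        using a(3) False by (auto simp: cong_sym_eq)
      have "x = a \<or> x = int p - a" if "x \<in> ?S" for x
      proof -
        have x: "0 \<le> x" "x < int p" "[u * x\<^sup>2 = v] (mod int p)"
          using that by auto
        have "[u * x\<^sup>2 = u * a\<^sup>2] (mod int p)"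
          using x(3) a(3) cong_sym cong_trans by blast
        from square_eq[OF this] show ?thesis
        proof
          assume "int p dvd x - a"
          then have "[x = a] (mod int p)"
            by (simp add: cong_iff_dvd_diff)
          with x a show ?thesis
            using cong_less_imp_eq_int by blast
        next
          assume "int p dvd x + a"
          then have "[x = int p - a] (mod int p)"
            by (simp add: cong_iff_dvd_diff algebra_simps)
          with x a \<open>a \<noteq> 0\<close> show ?thesis
            using cong_less_imp_eq_int[of x "int p" "int p - a"] by auto
        qed
      qed
      moreover have "[u * (int p - a)\<^sup>2 = v] (mod int p)"
      proof -
        have "[int p - a = - a] (mod int p)"
          by (simp add: cong_iff_dvd_diff)
        then have "[u * (int p - a)\<^sup>2 = u * (- a)\<^sup>2] (mod int p)"
          by (intro cong_mult cong_pow cong_refl)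
        then show ?thesis
          using a(3) cong_trans by auto
      qed
      ultimately have "?S = {a, int p - a}"
        using a \<open>a \<noteq> 0\<close> by auto
      moreover have "a \<noteq> int p - a"
      proof
        assume "a = int p - a"
        then have "even (int p)" by presburger
        then show False
          using assms(1,2) prime_odd_nat by auto
      qed
      ultimately have "card ?S = 2" by simp
      moreover have "QuadRes (int p) (u * v)"
        unfolding QuadRes_def
      proof
        have "[u * (u * a\<^sup>2) = u * v] (mod int p)"
          by (intro cong_mult a cong_refl)
        then show "[(u * a)\<^sup>2 = u * v] (mod int p)"
          by (simp add: power2_eq_square algebra_simps)
      qed
      ultimately show ?thesis
        using nz by (simp add: Legendre_def)
    qed
  qed
qed

section \<open>Power sums over the prime field\<close>

text \<open>If \<open>p - 1\<close> divides \<open>k > 0\<close>, Fermat makes all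
  \<open>p - 1\<close> nonzero terms equal to 1. Otherwise multiplication by a primitive root
  \<open>g\<close> permutes the nonzero residues, so \<open>(g^k - 1) * s = 0\<close> for the sum
  \<open>s\<close>, while \<open>g^k\<close> is not 1.\<close>

lemma sum_power_residues_cong:
  fixes p k :: nat
  assumes "prime p"
  shows "[(\<Sum>y\<in>{0..<int p}. y ^ k) = (if k > 0 \<and> (p - 1) dvd k then -1 else 0)] (mod int p)"
proof (cases "k = 0")
  \<comment> \<open>Here \<open>0 ^ 0 = 1\<close>, so all \<open>p\<close> terms are 1 and the sum
    vanishes modulo \<open>p\<close>; hence the condition \<open>k > 0\<close> in the
    statement.\<close>
  case True
  then show ?thesis by (simp add: cong_0_iff)
next
  case False
  have p: "p > 1" "prime (int p)"
    using assms prime_gt_1_nat by auto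
  have "{0..<int p} = insert 0 {1..<int p}"
    using p by auto
  then have split: "(\<Sum>y\<in>{0..<int p}. y ^ k) = (\<Sum>y\<in>{1..<int p}. y ^ k)"
    using False by (simp add: zero_power)
  show ?thesis
  proof (cases "(p - 1) dvd k")
    case True
    then obtain c where c: "k = (p - 1) * c" by blast
    have "[y ^ k = 1] (mod int p)" if "y \<in> {1..<int p}" for y
    proof -
      have "\<not> p dvd nat y"
        using that by (auto dest!: dvd_imp_le)
      then have "[nat y ^ (p - 1) = 1] (mod p)"
        using fermat_theorem assms by blast
      then have "[int (nat y) ^ (p - 1) = 1] (mod int p)"
        by (metis cong_int_iff of_nat_1 of_nat_power)
      then have "[(y ^ (p - 1)) ^ c = 1 ^ c] (mod int p)"
        using that by (intro cong_pow) auto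
      then show ?thesis by (simp add: c power_mult)
    qed
    then have "[(\<Sum>y\<in>{1..<int p}. y ^ k) = (\<Sum>y\<in>{1..<int p}. 1)] (mod int p)"
      by (intro cong_sum)
    also have "(\<Sum>y\<in>{1..<int p}. 1) = int p - 1"
      using p by simp
    also have "[int p - 1 = -1] (mod int p)"
      by (simp add: cong_iff_dvd_diff)
    finally show ?thesis
      using split True False by simp
  next
    case ndvd: False
    obtain g where "ord p g = p - 1" "coprime p g"
      using residue_prime_has_primroot[OF assms]
      by (auto simp: totatives_def coprime_commute)
    with ndvd have "\<not> [g ^ k = 1] (mod p)"
      unfolding ord_divides by simp
    then have g1: "\<not> [int g ^ k = 1] (mod int p)"
      by (metis cong_int_iff of_nat_1 of_nat_power)
    have cop: "coprime (int g) (int p)"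
      using \<open>coprime p g\<close> by (simp add: coprime_commute)
    let ?s = "\<Sum>y\<in>{1..<int p}. y ^ k"
    have "?s = (\<Sum>y\<in>{1..<int p}. (int g * y mod int p) ^ k)"
      by (rule sum.reindex_bij_betw[OF bij_betw_int_remainders_mult[OF cop], symmetric])
    also have "[\<dots> = (\<Sum>y\<in>{1..<int p}. (int g * y) ^ k)] (mod int p)"
      by (intro cong_sum cong_pow) simp
    also have "(\<Sum>y\<in>{1..<int p}. (int g * y) ^ k) = int g ^ k * ?s"
      by (simp add: power_mult_distrib sum_distrib_left)
    finally have "int p dvd (int g ^ k - 1) * ?s"
      by (simp add: cong_iff_dvd_diff algebra_simps dvd_diff_commute)
    then have "int p dvd ?s"
      using g1 p(2) by (simp add: prime_dvd_mult_iff cong_iff_dvd_diff)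
    then show ?thesis
      using split ndvd by (simp add: cong_0_iff)
  qed
qed

section \<open>The binomial sum as a power sum over \<open>y\<close>\<close>

text \<open>For a prime \<open>p = 2 * m + 1\<close> this is the Deuring polynomial, whose roots in
  characteristic \<open>p\<close> are the parameters of the supersingular Legendre curves.\<close>

definition hasse_sum :: "nat \<Rightarrow> int \<Rightarrow> int" where
  "hasse_sum m d = (\<Sum>j = 0..m. (int (m choose j))\<^sup>2 * d ^ j)"

lemma one_minus_power_binomial:
  fixes a :: int
  shows "(1 - a) ^ m = (\<Sum>i\<le>m. int (m choose i) * (- a) ^ i)"
  using binomial_ring[of "- a" 1 m] by simp

text \<open>After binomial expansion of both factors, the sum of \<open>y ^ (2 * (i + j))\<close>
  over \<open>y\<close> is -1 for \<open>i + j = m\<close> or \<open>i + j = 2 * m\<close> and 0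
  otherwise. The antidiagonal \<open>i + j = m\<close> yields the squared binomials, the corner
  \<open>i = j = m\<close> yields \<open>d ^ m\<close>.\<close>

lemma sum_edwards_power_cong:
  fixes p m :: nat and d :: int
  assumes "prime p" "p = 2 * m + 1"
  shows "[(\<Sum>y\<in>{0..<int p}. ((1 - d * y\<^sup>2) * (1 - y\<^sup>2)) ^ m)
           = - ((-1) ^ m * hasse_sum m d) - d ^ m] (mod int p)"
proof -
  have "m > 0"
    using assms by (cases m) auto
  define c where "c i j = int (m choose i) * (- d) ^ i * (int (m choose j) * (-1) ^ j)" for i j
  have expand: "((1 - d * y\<^sup>2) * (1 - y\<^sup>2)) ^ m = (\<Sum>i\<le>m. \<Sum>j\<le>m. c i j * y ^ (2 * (i + j)))"
    for y :: int
  proof -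
    have "(- (d * y\<^sup>2)) ^ i = (- d) ^ i * y ^ (2 * i)" for i
      by (metis minus_mult_left power_mult power_mult_distrib)
    moreover have "(- (y\<^sup>2)) ^ i = (-1) ^ i * y ^ (2 * i)" for i
      by (metis mult_minus1 power_mult power_mult_distrib)
    ultimately show ?thesis
      unfolding power_mult_distrib one_minus_power_binomial sum_product
      by (intro sum.cong refl) (simp add: c_def power_add algebra_simps)
  qed
  have dvd_iff: "k > 0 \<and> m dvd k \<longleftrightarrow> k = m \<or> k = 2 * m" if "k \<le> 2 * m" for k
  proof
    assume k: "k > 0 \<and> m dvd k"
    then obtain c where c: "k = m * c" by blast
    then have "c \<noteq> 0" "c \<le> 2"
      using k that \<open>m > 0\<close> by auto
    then have "c = 1 \<or> c = 2" by linarith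
    then show "k = m \<or> k = 2 * m" using c by auto
  qed (use \<open>m > 0\<close> in auto)
  \<comment> \<open>The indicator splits into two conditions that fix \<open>j\<close>, so that the
    inner sums collapse. The cases exclude each other because \<open>m > 0\<close>.\<close>
  have select: "z * (if i + j = m \<or> i + j = 2 * m then -1 else 0)
      = (if j = m - i then - z else 0) + (if j = m then if i = m then - z else 0 else 0)"
    if "i \<le> m" "j \<le> m" for z :: int and i j
  proof -
    have "i + j = m \<longleftrightarrow> j = m - i" "i + j = 2 * m \<longleftrightarrow> i = m \<and> j = m"
      "j = m - i \<Longrightarrow> \<not> (i = m \<and> j = m)"
      using that \<open>m > 0\<close> by auto
    then show ?thesis by auto
  qed
  have diagonal: "c i (m - i) = (-1) ^ m * ((int (m choose i))\<^sup>2 * d ^ i)" if "i \<le> m" for i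
  proof -
    have "(- d) ^ i * (-1) ^ (m - i) = d ^ i * ((-1) ^ i * (-1) ^ (m - i))"
      by (simp add: power_minus[of d])
    also have "(-1::int) ^ i * (-1) ^ (m - i) = (-1) ^ m"
      using that by (simp flip: power_add)
    finally have "(- d) ^ i * (-1) ^ (m - i) = d ^ i * (-1) ^ m" .
    moreover have "c i (m - i) = (int (m choose i))\<^sup>2 * ((- d) ^ i * (-1) ^ (m - i))"
      using binomial_symmetric[OF that] by (simp add: c_def power2_eq_square)
    ultimately show ?thesis by simp
  qed
  have corner: "c m m = d ^ m"
    by (simp add: c_def flip: power_mult_distrib)
  have "(\<Sum>y\<in>{0..<int p}. ((1 - d * y\<^sup>2) * (1 - y\<^sup>2)) ^ m)
      = (\<Sum>i\<le>m. \<Sum>j\<le>m. c i j * (\<Sum>y\<in>{0..<int p}. y ^ (2 * (i + j))))"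
    unfolding expand sum_distrib_left
    by (subst sum.swap, intro sum.cong refl, subst sum.swap) (rule refl)
  moreover have "[(\<Sum>i\<le>m. \<Sum>j\<le>m. c i j * (\<Sum>y\<in>{0..<int p}. y ^ (2 * (i + j))))
      = (\<Sum>i\<le>m. \<Sum>j\<le>m. c i j * (if i + j = m \<or> i + j = 2 * m then -1 else 0))] (mod int p)"
  proof (intro cong_sum cong_mult cong_refl)
    fix i j assume ij: "i \<in> {..m}" "j \<in> {..m}"
    have "2 * (i + j) > 0 \<and> (p - 1) dvd 2 * (i + j) \<longleftrightarrow> i + j > 0 \<and> m dvd i + j"
      unfolding assms(2) add_diff_cancel_right' nat_mult_dvd_cancel_disj by simp
    also have "\<dots> \<longleftrightarrow> i + j = m \<or> i + j = 2 * m"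
      using ij by (intro dvd_iff) auto
    finally show "[(\<Sum>y\<in>{0..<int p}. y ^ (2 * (i + j)))
        = (if i + j = m \<or> i + j = 2 * m then -1 else 0)] (mod int p)"
      using sum_power_residues_cong[OF assms(1), of "2 * (i + j)"] by presburger
  qed
  moreover have "(\<Sum>i\<le>m. \<Sum>j\<le>m. c i j * (if i + j = m \<or> i + j = 2 * m then -1 else 0))
      = (\<Sum>i\<le>m. \<Sum>j\<le>m. (if j = m - i then - c i j else 0)
           + (if j = m then if i = m then - c i j else 0 else 0))"
    by (intro sum.cong refl select) auto
  moreover have "\<dots> = (\<Sum>i\<le>m. - c i (m - i)) + - c m m"
    unfolding sum.distrib by simp
  moreover have "(\<Sum>i\<le>m. - c i (m - i)) = - ((-1) ^ m * hasse_sum m d)"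
    by (simp add: diagonal hasse_sum_def sum_negf sum_distrib_left atLeast0AtMost)
  ultimately show ?thesis
    by (simp add: corner)
qed

section \<open>Fibres of the curve over the coordinate \<open>y\<close>\<close>

lemma Legendre_range: "Legendre a n \<in> {-1, 0, 1}"
  by (simp add: Legendre_def)

text \<open>The curve equation for fixed \<open>y\<close>, rearranged into the shape of
  \<open>card_quadratic_solutions\<close>.\<close>

definition edwards_fibre :: "nat \<Rightarrow> int \<Rightarrow> int \<Rightarrow> int set" where
  "edwards_fibre p d y = {x \<in> {0..<int p}. [(1 - d * y\<^sup>2) * x\<^sup>2 = 1 - y\<^sup>2] (mod int p)}"

lemma edwards_order_eq_sum_fibres:
  "edwards_order p d = (\<Sum>y\<in>{0..<int p}. card (edwards_fibre p d y))"
proof -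
  have "[x\<^sup>2 + y\<^sup>2 = 1 + d * x\<^sup>2 * y\<^sup>2] (mod int p)
      \<longleftrightarrow> [(1 - d * y\<^sup>2) * x\<^sup>2 = 1 - y\<^sup>2] (mod int p)" for x y
  proof -
    have "x\<^sup>2 + y\<^sup>2 - (1 + d * x\<^sup>2 * y\<^sup>2) = (1 - d * y\<^sup>2) * x\<^sup>2 - (1 - y\<^sup>2)"
      by (simp add: algebra_simps)
    then show ?thesis by (simp only: cong_iff_dvd_diff)
  qed
  then have "edwards_points p d
      = prod.swap ` (SIGMA y:{0..<int p}. edwards_fibre p d y)"
    by (auto simp: edwards_points_def edwards_fibre_def image_iff)
  then have "edwards_order p d = card (SIGMA y:{0..<int p}. edwards_fibre p d y)"
    by (simp add: edwards_order_def card_image)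
  moreover have "finite (edwards_fibre p d y)" for y
    unfolding edwards_fibre_def by (rule finite_Collect_conjI) simp
  ultimately show ?thesis
    by simp
qed

text \<open>Where \<open>d * y^2 = 1\<close>, a point would force \<open>y^2 = 1\<close> and hence
  \<open>d = 1\<close>. Elsewhere the coefficient of \<open>x^2\<close> is a unit and the quadratic
  count applies.\<close>

lemma card_edwards_fibre:
  assumes "prime p" "2 < p" "\<not> [d = 1] (mod int p)"
  shows "int (card (edwards_fibre p d y)) =
    (if [d * y\<^sup>2 = 1] (mod int p) then 0
     else 1 + Legendre ((1 - d * y\<^sup>2) * (1 - y\<^sup>2)) (int p))"
proof (cases "[d * y\<^sup>2 = 1] (mod int p)")
  case True
  then have dvd: "int p dvd 1 - d * y\<^sup>2"
    by (simp add: cong_iff_dvd_diff dvd_diff_commute)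
  have "edwards_fibre p d y = {}"
  proof (rule ccontr)
    assume "edwards_fibre p d y \<noteq> {}"
    then obtain x where "int p dvd (1 - d * y\<^sup>2) * x\<^sup>2 - (1 - y\<^sup>2)"
      by (auto simp: edwards_fibre_def cong_iff_dvd_diff)
    with dvd have y: "int p dvd 1 - y\<^sup>2"
      using dvd_diff_right_iff dvd_mult2 by blast
    have "d - 1 = d * (1 - y\<^sup>2) - (1 - d * y\<^sup>2)"
      by (simp add: algebra_simps)
    with y dvd have "int p dvd d - 1"
      by (metis dvd_diff dvd_mult)
    with assms(3) show False
      by (simp add: cong_iff_dvd_diff)
  qed
  with True show ?thesis by simp
next
  case False
  then have "\<not> [1 - d * y\<^sup>2 = 0] (mod int p)"
    by (simp add: cong_iff_dvd_diff dvd_diff_commute)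
  from card_quadratic_solutions[OF assms(1,2) this] False show ?thesis
    by (simp add: edwards_fibre_def)
qed

text \<open>Counts the empty fibres: the quadratic count with \<open>u = d\<close> and
  \<open>v = 1\<close>.\<close>

lemma card_edwards_singular:
  assumes "prime p" "2 < p" "\<not> [d = 0] (mod int p)"
  shows "(\<Sum>y\<in>{0..<int p}. if [d * y\<^sup>2 = 1] (mod int p) then 1 else 0) = 1 + Legendre d (int p)"
  using card_quadratic_solutions[OF assms, of 1] by (simp add: sum.If_cases Int_def)

section \<open>The order modulo \<open>p\<close> and its exact value\<close>

text \<open>The Legendre symbol of \<open>d\<close> enters twice: through the number of empty fibres
  and, by Euler's criterion, through the corner term \<open>d ^ m\<close>.\<close>

lemma edwards_order_cong:
  fixes p m :: nat and d :: int
  assumes "prime p" "p = 2 * m + 1" "\<not> [d = 0] (mod int p)" "\<not> [d = 1] (mod int p)"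
  shows "[int (edwards_order p d)
          = - 1 - 2 * Legendre d (int p) - (-1) ^ m * hasse_sum m d] (mod int p)"
proof -
  have m: "(p - 1) div 2 = m" and "m > 0"
    using assms(1,2) by (cases m; simp)+
  then have "2 < p"
    using assms(2) by simp
  have euler: "[Legendre a (int p) = a ^ m] (mod int p)" for a
    using euler_criterion[OF assms(1) \<open>2 < p\<close>] m by simp
  let ?s = "\<lambda>y. if [d * y\<^sup>2 = 1] (mod int p) then 1 else 0 :: int"
  let ?f = "\<lambda>y. (1 - d * y\<^sup>2) * (1 - y\<^sup>2)"
  \<comment> \<open>One formula covers both kinds of fibre: where \<open>?s y = 1\<close>, the
    factor \<open>1 - d * y^2\<close> makes \<open>?f y ^ m\<close> vanish modulo
    \<open>p\<close>.\<close>
  have "[int (card (edwards_fibre p d y)) = 1 - ?s y + ?f y ^ m] (mod int p)" for y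
  proof (cases "[d * y\<^sup>2 = 1] (mod int p)")
    case True
    then have "int p dvd ?f y ^ m"
      using \<open>m > 0\<close>
      by (intro dvd_trans[OF _ dvd_power] dvd_mult2)
        (auto simp: cong_iff_dvd_diff dvd_diff_commute)
    then show ?thesis
      using True card_edwards_fibre[OF assms(1) \<open>2 < p\<close> assms(4)]
      by (simp add: cong_iff_dvd_diff)
  next
    case False
    then show ?thesis
      using card_edwards_fibre[OF assms(1) \<open>2 < p\<close> assms(4)] euler by (simp add: cong_add)
  qed
  then have "[int (edwards_order p d) = (\<Sum>y\<in>{0..<int p}. 1 - ?s y + ?f y ^ m)] (mod int p)"
    unfolding edwards_order_eq_sum_fibres of_nat_sum by (intro cong_sum)
  also have "(\<Sum>y\<in>{0..<int p}. 1 - ?s y + ?f y ^ m)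
      = int p - (1 + Legendre d (int p)) + (\<Sum>y\<in>{0..<int p}. ?f y ^ m)"
    using card_edwards_singular[OF assms(1) \<open>2 < p\<close> assms(3)]
    by (simp add: sum.distrib sum_subtractf)
  also have "[\<dots> = 0 - (1 + Legendre d (int p))
      + (- ((-1) ^ m * hasse_sum m d) - Legendre d (int p))] (mod int p)"
  proof (intro cong_add cong_diff cong_refl)
    have "[- ((-1) ^ m * hasse_sum m d) - d ^ m
        = - ((-1) ^ m * hasse_sum m d) - Legendre d (int p)] (mod int p)"
      by (intro cong_diff cong_refl cong_sym[OF euler])
    with sum_edwards_power_cong[OF assms(1,2)]
    show "[(\<Sum>y\<in>{0..<int p}. ?f y ^ m)
        = - ((-1) ^ m * hasse_sum m d) - Legendre d (int p)] (mod int p)"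
      by (rule cong_trans)
  qed (simp add: cong_0_iff)
  finally show ?thesis
    by (simp add: algebra_simps)
qed

lemma edwards_order_bounds:
  fixes p :: nat and d :: int
  assumes "prime p" "2 < p" "\<not> [d = 0] (mod int p)" "\<not> [d = 1] (mod int p)"
  shows "2 \<le> int (edwards_order p d)"
    and "int (edwards_order p d) \<le> 2 * int p - 2 * (1 + Legendre d (int p)) - 2"
proof -
  let ?n = "\<lambda>y. int (card (edwards_fibre p d y))"
  let ?e = "\<lambda>y. (if y = 1 then 1 else 0) + (if y = int p - 1 then 1 else 0) :: int"
  let ?s = "\<lambda>y. if [d * y\<^sup>2 = 1] (mod int p) then 1 else 0 :: int"
  \<comment> \<open>Over these \<open>y\<close> one has \<open>d * y^2 = d\<close>, which is not 1,
    so the one-point fibres are disjoint from the empty ones and both corrections to the trivial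
    bound 2 per fibre can be subtracted.\<close>
  have one: "?n y = 1 \<and> ?s y = 0" if "y = 1 \<or> y = int p - 1" for y
  proof -
    have y: "[y\<^sup>2 = 1] (mod int p)"
    proof -
      have "int p dvd (y - 1) * (y + 1)"
        using that by auto
      then show ?thesis
        by (simp add: cong_iff_dvd_diff power2_eq_square algebra_simps)
    qed
    then have "[d * y\<^sup>2 = d * 1] (mod int p)"
      by (intro cong_mult cong_refl)
    then have "\<not> [d * y\<^sup>2 = 1] (mod int p)"
      using assms(4) by (simp add: cong_def)
    moreover have "[(1 - d * y\<^sup>2) * (1 - y\<^sup>2) = 0] (mod int p)"
      using y by (simp add: cong_iff_dvd_diff dvd_diff_commute)
    ultimately show ?thesis
      using card_edwards_fibre[OF assms(1,2,4)] by (simp add: Legendre_def)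
  qed
  have e: "(\<Sum>y\<in>{0..<int p}. ?e y) = 2"
    using assms(2) by (simp add: sum.distrib)
  have N: "int (edwards_order p d) = (\<Sum>y\<in>{0..<int p}. ?n y)"
    by (simp add: edwards_order_eq_sum_fibres)
  have "?e y \<le> ?n y" for y
    using one[of y] assms(2) by auto
  then show "2 \<le> int (edwards_order p d)"
    unfolding N e[symmetric] by (intro sum_mono)
  have "?n y \<le> 2 - 2 * ?s y - ?e y" for y
  proof (cases "y = 1 \<or> y = int p - 1")
    case True
    then show ?thesis
      using one[of y] assms(2) by auto
  next
    case False
    then show ?thesis
      using card_edwards_fibre[OF assms(1,2,4), of y]
        Legendre_range[of "(1 - d * y\<^sup>2) * (1 - y\<^sup>2)" "int p"] by auto
  qed
  then have "int (edwards_order p d) \<le> (\<Sum>y\<in>{0..<int p}. 2 - 2 * ?s y - ?e y)"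
    unfolding N by (intro sum_mono)
  also have "\<dots> = 2 * int p - 2 * (\<Sum>y\<in>{0..<int p}. ?s y) - (\<Sum>y\<in>{0..<int p}. ?e y)"
    by (simp only: sum_subtractf sum_distrib_left) simp
  finally show "int (edwards_order p d) \<le> 2 * int p - 2 * (1 + Legendre d (int p)) - 2"
    unfolding e card_edwards_singular[OF assms(1-3)] .
qed

lemma edwards_order_supersingular:
  fixes p m :: nat and d :: int
  assumes "prime p" "p = 2 * m + 1" "\<not> [d = 0] (mod int p)" "\<not> [d = 1] (mod int p)"
    and "[hasse_sum m d = 0] (mod int p)"
  shows "int (edwards_order p d) = int p - 1 - 2 * Legendre d (int p)"
proof -
  have "2 < p"
    using assms(1,2) by (cases m) auto
  let ?N = "int (edwards_order p d)" and ?L = "Legendre d (int p)"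
  have "[?N = - 1 - 2 * ?L - (-1) ^ m * hasse_sum m d] (mod int p)"
    by (rule edwards_order_cong[OF assms(1-4)])
  also have "[- 1 - 2 * ?L - (-1) ^ m * hasse_sum m d
      = - 1 - 2 * ?L - (-1) ^ m * 0] (mod int p)"
    by (intro cong_diff cong_mult cong_refl assms(5))
  finally have "int p dvd ?N - (- 1 - 2 * ?L)"
    by (simp add: cong_iff_dvd_diff)
  then obtain k where k: "?N = - 1 - 2 * ?L + int p * k"
    by (auto simp: dvd_def algebra_simps)
  note bounds = edwards_order_bounds[OF assms(1) \<open>2 < p\<close> assms(3,4)]
  have "?L \<in> {-1, 1}"
    using assms(3) by (simp add: Legendre_def)
  \<comment> \<open>The lower bound gives \<open>p * k >= 3 + 2 * ?L >= 1\<close>; in the upper one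
    \<open>?L\<close> cancels, leaving \<open>p * k <= 2 * p - 3\<close>.\<close>
  then have "int p * k > int p * 0" "int p * k < int p * 2"
    using k bounds by auto
  then have "k = 1"
    using \<open>2 < p\<close> by (simp only: mult_less_cancel_left_pos)
  then show ?thesis using k by simp
qed

section \<open>Invariance under inversion of \<open>d\<close>\<close>

text \<open>Since \<open>d^m * e^j = d^(m-j) * (d * e)^j\<close>, multiplying by \<open>d^m\<close>
  reverses the coefficients, and these are symmetric under \<open>j -> m - j\<close>.\<close>

lemma hasse_sum_inverse:
  assumes "[d * e = 1] (mod n)"
  shows "[d ^ m * hasse_sum m e = hasse_sum m d] (mod n)"
proof -
  have "[(int (m choose j))\<^sup>2 * (d ^ m * e ^ j) = (int (m choose (m - j)))\<^sup>2 * d ^ (m - j)] (mod n)"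
    if "j \<le> m" for j
  proof -
    have "d ^ m * e ^ j = d ^ (m - j) * (d * e) ^ j"
      using that by (simp add: power_mult_distrib flip: power_add mult.assoc)
    moreover have "[d ^ (m - j) * (d * e) ^ j = d ^ (m - j) * 1 ^ j] (mod n)"
      by (intro cong_mult cong_pow cong_refl assms)
    ultimately show ?thesis
      using binomial_symmetric[OF that] by (auto intro: cong_mult)
  qed
  then have "[(\<Sum>j=0..m. (int (m choose j))\<^sup>2 * (d ^ m * e ^ j))
      = (\<Sum>j=0..m. (int (m choose (m - j)))\<^sup>2 * d ^ (m - j))] (mod n)"
    by (intro cong_sum) auto
  also have "(\<Sum>j=0..m. (int (m choose (m - j)))\<^sup>2 * d ^ (m - j)) = hasse_sum m d"
    unfolding hasse_sum_def by (subst (2) sum.atLeastAtMost_rev) simp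
  finally show ?thesis
    by (simp add: hasse_sum_def sum_distrib_left algebra_simps)
qed

text \<open>If \<open>y^2 = a\<close> and \<open>a * b = 1\<close>, then
  \<open>(y * b)^2 = b\<close>, so squares have square inverses.\<close>

lemma Legendre_inverse:
  assumes "[d * e = 1] (mod n)"
  shows "Legendre e n = Legendre d n"
proof -
  have QuadRes_inverse: "QuadRes n b" if "QuadRes n a" "[a * b = 1] (mod n)" for a b
  proof -
    obtain y where y: "[y\<^sup>2 = a] (mod n)"
      using \<open>QuadRes n a\<close> unfolding QuadRes_def by blast
    have "[y\<^sup>2 * b\<^sup>2 = a * b\<^sup>2] (mod n)"
      by (intro cong_mult y cong_refl)
    also have "a * b\<^sup>2 = a * b * b"
      by (simp add: power2_eq_square)
    also have "[a * b * b = 1 * b] (mod n)"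
      by (intro cong_mult that cong_refl)
    finally have "[(y * b)\<^sup>2 = b] (mod n)"
      by (simp add: power_mult_distrib)
    then show ?thesis
      unfolding QuadRes_def by blast
  qed
  have zero_inverse: "[b = 0] (mod n)" if "[a = 0] (mod n)" "[a * b = 1] (mod n)" for a b
  proof -
    have "[a * b * b = 0 * b * b] (mod n)"
      by (intro cong_mult that cong_refl)
    moreover have "[a * b * b = 1 * b] (mod n)"
      by (intro cong_mult that cong_refl)
    ultimately show ?thesis
      by (simp add: cong_def)
  qed
  have "[e * d = 1] (mod n)"
    using assms by (simp add: mult.commute)
  with assms have "QuadRes n e \<longleftrightarrow> QuadRes n d" "[e = 0] (mod n) \<longleftrightarrow> [d = 0] (mod n)"
    using QuadRes_inverse zero_inverse by blast+
  then show ?thesis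
    by (simp add: Legendre_def)
qed

section \<open>The orders for \<open>d\<close> and its inverse\<close>

theorem theorem1:
  fixes p :: nat and d :: int
  assumes "prime p"
    and "[p = 3] (mod 4)"
    and "\<not> [d = 0] (mod int p)"
    and "\<not> [d = 1] (mod int p)"
    and "[(\<Sum>j = 0..(p - 1) div 2. (int (((p - 1) div 2) choose j))\<^sup>2 * d ^ j) = 0] (mod int p)"
  shows "(Legendre d (int p) = -1 \<longrightarrow>
            edwards_order p d = p + 1 \<and>
            edwards_order p (modular_inverse (int p) d) = p + 1) \<and>
         (Legendre d (int p) = 1 \<longrightarrow>
            edwards_order p d = p - 3 \<and>
            edwards_order p (modular_inverse (int p) d) = p - 3)"
proof -
  define m where "m = (p - 1) div 2"
  define e where "e = modular_inverse (int p) d"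
  have p: "p = 2 * m + 1" "p \<ge> 3"
    using assms(2) prime_gt_1_nat[OF assms(1)] unfolding m_def cong_def by presburger+
  have "prime (int p)" using assms(1) by simp
  then have "coprime d (int p)"
    using assms(3) by (metis cong_0_iff coprime_commute prime_imp_coprime)
  then have de: "[d * e = 1] (mod int p)"
    unfolding e_def by (rule cong_modular_inverse1)
  have H: "[hasse_sum m d = 0] (mod int p)"
    using assms(5) by (simp add: hasse_sum_def m_def)
  have L: "Legendre e (int p) = Legendre d (int p)"
    by (rule Legendre_inverse[OF de])
  have e0: "\<not> [e = 0] (mod int p)"
    using L assms(3) by (auto simp: Legendre_def split: if_splits)
  have e1: "\<not> [e = 1] (mod int p)"
  proof
    assume "[e = 1] (mod int p)"
    then have "[d * e = d * 1] (mod int p)"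
      by (intro cong_mult cong_refl)
    with de assms(4) show False
      by (simp add: cong_def)
  qed
  have "[d ^ m * hasse_sum m e = 0] (mod int p)"
    using hasse_sum_inverse[OF de] H by (rule cong_trans)
  \<comment> \<open>The prime \<open>p\<close> does not divide \<open>d ^ m\<close>, so this factor
    can be cancelled.\<close>
  then have He: "[hasse_sum m e = 0] (mod int p)"
    using \<open>prime (int p)\<close> assms(3) prime_dvd_power[of "int p" d m]
    by (auto simp: cong_0_iff prime_dvd_mult_iff)
  have "int (edwards_order p d) = int p - 1 - 2 * Legendre d (int p)"
    using edwards_order_supersingular[OF assms(1) p(1) assms(3,4) H] .
  moreover have "int (edwards_order p e) = int p - 1 - 2 * Legendre d (int p)"
    using edwards_order_supersingular[OF assms(1) p(1) e0 e1 He] L by simp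
  \<comment> \<open>The bound \<open>p >= 3\<close> keeps the subtraction \<open>p - 3\<close> on
    natural numbers from being truncated.\<close>
  ultimately show ?thesis
    using p(2) unfolding e_def[symmetric] by auto
qed

end
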